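(* Let $n \geq 1$ be an integer and suppose that $G \subseteq \operatorname{U}_n(\mathbb{C})$ is a finitely generated subgroup with polynomial growth. Then $G$ is virtually abelian, i.e. $G$ has an abelian subgroup of finite index.
   Context: $\operatorname{U}_n(\mathbb{C})$ is the group of $n \times n$ complex unitary matrices. A group $G$ has polynomial growth (with exponent $d$) if there is a finite symmetric set $\Sigma$ of generators of $G$ and a constant $B = B_{\Sigma}$ such that $|\Sigma^r| \leq B r^d$ for all integers $r \geq 1$, where $\Sigma^r$ denotes the set of all products of $r$ elements of $\Sigma$. *)

theory Defs
  imports "HOL-Analysis.Analysis" "HOL-Algebra.Algebra"
begin

definition conj_transpose :: "complex^'n^'m \<Rightarrow> complex^'m^'n" where
  "conj_transpose A = (\<chi> i j. cnj (A $ j $ i))"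

text \<open>The dimension is \<open>n = CARD('n)\<close>, which is at least 1 because types are nonempty.\<close>

definition unitary_group :: "(complex^'n^'n) monoid" where
  "unitary_group =
     \<lparr>carrier = {A. conj_transpose A ** A = mat 1 \<and> A ** conj_transpose A = mat 1},
      monoid.mult = (**),
      one = mat 1\<rparr>"

definition finitely_generated :: "('a, 'b) monoid_scheme \<Rightarrow> bool" where
  "finitely_generated G \<longleftrightarrow>
     (\<exists>S. finite S \<and> S \<subseteq> carrier G \<and> generate G S = carrier G)"

text \<open>\<open>set_pow G S r\<close> is the set of products of exactly \<open>r\<close> elements of \<open>S\<close>.\<close>

primrec set_pow :: "('a, 'b) monoid_scheme \<Rightarrow> 'a set \<Rightarrow> nat \<Rightarrow> 'a set" where
  "set_pow G S 0 = {\<one>\<^bsub>G\<^esub>}"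
| "set_pow G S (Suc r) = set_pow G S r <#>\<^bsub>G\<^esub> S"

definition polynomial_growth_exponent :: "('a, 'b) monoid_scheme \<Rightarrow> real \<Rightarrow> bool" where
  "polynomial_growth_exponent G d \<longleftrightarrow>
     (\<exists>S B. finite S \<and> S \<subseteq> carrier G \<and> (\<forall>s\<in>S. inv\<^bsub>G\<^esub> s \<in> S) \<and> generate G S = carrier G \<and>
        (\<forall>r\<ge>1. real (card (set_pow G S r)) \<le> B * real r powr d))"

definition polynomial_growth :: "('a, 'b) monoid_scheme \<Rightarrow> bool" where
  "polynomial_growth G \<longleftrightarrow> (\<exists>d. polynomial_growth_exponent G d)"

definition virtually_abelian :: "('a, 'b) monoid_scheme \<Rightarrow> bool" where
  "virtually_abelian G \<longleftrightarrow>
     (\<exists>H. subgroup H G \<and> comm_group (G\<lparr>carrier := H\<rparr>) \<and> finite (rcosets\<^bsub>G\<^esub> H))"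

lemma conj_transpose_mult: "conj_transpose (A ** B) = conj_transpose B ** conj_transpose A"
  by (simp add: conj_transpose_def matrix_matrix_mult_def vec_eq_iff mult.commute)

lemma conj_transpose_conj_transpose [simp]: "conj_transpose (conj_transpose A) = A"
  by (simp add: conj_transpose_def vec_eq_iff)

lemma conj_transpose_mat_1 [simp]: "conj_transpose (mat 1) = mat 1"
  by (simp add: conj_transpose_def mat_def vec_eq_iff)

lemma group_unitary_group: "group (unitary_group :: (complex^'n^'n) monoid)"
proof (rule groupI)
  fix A B :: "complex^'n^'n"
  assume A: "A \<in> carrier unitary_group" and B: "B \<in> carrier unitary_group"
  have "conj_transpose B ** conj_transpose A ** (A ** B)
      = conj_transpose B ** (conj_transpose A ** A) ** B"
    "A ** B ** (conj_transpose B ** conj_transpose A)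
      = A ** (B ** conj_transpose B) ** conj_transpose A"
    by (simp_all add: matrix_mul_assoc)
  then show "A \<otimes>\<^bsub>unitary_group\<^esub> B \<in> carrier unitary_group"
    using A B by (simp add: unitary_group_def conj_transpose_mult)
next
  fix A :: "complex^'n^'n"
  assume "A \<in> carrier unitary_group"
  then show "\<exists>B\<in>carrier unitary_group. B \<otimes>\<^bsub>unitary_group\<^esub> A = \<one>\<^bsub>unitary_group\<^esub>"
    by (intro bexI[of _ "conj_transpose A"]) (auto simp: unitary_group_def)
qed (auto simp: unitary_group_def matrix_mul_assoc)

end

theory Submission
  imports Defs "HOL-Real_Asymp.Real_Asymp"
begin

text \<open>
  Measure the size of a unitary \<open>g\<close> by the Frobenius norm \<open>\<parallel>g - 1\<parallel>\<close>, which is bi-invariant and satisfies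
  \<open>\<parallel>[g, h] - 1\<parallel> \<le> 2 \<parallel>g - 1\<parallel> \<parallel>h - 1\<parallel>\<close>. Let \<open>S\<close> be a finite set of group elements within \<open>\<epsilon>\<close> of the
  identity. If \<open>S\<close> does not commute, then from some \<open>h\<^sub>0 \<in> S\<close> one obtains a chain
  \<open>h\<^sub>k\<^sub>+\<^sub>1 = [h\<^sub>k, s\<^sub>k]\<close> with \<open>s\<^sub>k \<in> S\<close> in which no \<open>h\<^sub>k\<close> centralizes \<open>S\<close>, because near the identity
  a commutator that commutes with its entries is trivial. The sizes of the \<open>h\<^sub>k\<close> shrink by the
  factor \<open>2\<epsilon>\<close> at each step, so for \<open>M\<close> of order \<open>1/\<epsilon>\<close> the \<open>M\<^sup>m\<close> products
  \<open>h\<^sub>0\<^bsup>i\<^esup> h\<^sub>1\<^bsup>j\<^esup> \<dots>\<close> of \<open>m\<close> factors with exponents below \<open>M\<close> are distinct, whereas their word length is only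
  \<open>O(m 4\<^sup>m)\<close>. This contradicts growth of degree \<open>D\<close> once \<open>M > 4\<^sup>D\<close>. Hence \<open>S\<close> commutes, and taking
  for \<open>S\<close> a linear basis of the span of all elements of \<open>G\<close> within \<open>\<epsilon>\<close> of the identity, so do all of
  these. They generate a subgroup of finite index because \<open>G\<close> is totally bounded.
\<close>

section \<open>Subgroups generated by commuting elements\<close>

lemma (in group) commutes_generate:
  assumes S: "S \<subseteq> carrier G" and x: "x \<in> carrier G"
    and comm: "\<And>s. s \<in> S \<Longrightarrow> x \<otimes> s = s \<otimes> x" and y: "y \<in> generate G S"
  shows "x \<otimes> y = y \<otimes> x"
  using y
proof (induction y rule: generate.induct)
  case (inv s)
  then have s: "s \<in> carrier G" using S by blast
  have "inv s \<otimes> (x \<otimes> s) \<otimes> inv s = inv s \<otimes> (s \<otimes> x) \<otimes> inv s"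
    by (simp add: comm inv)
  moreover have "inv s \<otimes> (x \<otimes> s) \<otimes> inv s = inv s \<otimes> x"
    using s x by (simp add: m_assoc)
  moreover have "inv s \<otimes> (s \<otimes> x) \<otimes> inv s = x \<otimes> inv s"
    using s x by (simp add: m_assoc[symmetric])
  ultimately show ?case by simp
next
  case (eng y1 y2)
  then have "y1 \<in> carrier G" "y2 \<in> carrier G"
    using generate_in_carrier[OF S] by blast+
  then show ?case using eng x by (metis m_assoc)
qed (use x comm in auto)

lemma (in group) comm_group_generate:
  assumes S: "S \<subseteq> carrier G" and comm: "\<And>s t. s \<in> S \<Longrightarrow> t \<in> S \<Longrightarrow> s \<otimes> t = t \<otimes> s"
  shows "comm_group (G\<lparr>carrier := generate G S\<rparr>)"
proof (rule group.group_comm_groupI)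
  show "group (G\<lparr>carrier := generate G S\<rparr>)"
    using generate_is_subgroup[OF S] by (rule subgroup_imp_group)
  fix x y assume "x \<in> carrier (G\<lparr>carrier := generate G S\<rparr>)" "y \<in> carrier (G\<lparr>carrier := generate G S\<rparr>)"
  then have x: "x \<in> generate G S" and y: "y \<in> generate G S" by simp_all
  \<comment> \<open>\<open>commutes_generate\<close> is used twice: first for a generator against
    \<open>x\<close>, then for \<open>x\<close> against \<open>y\<close>.\<close>
  have "s \<otimes> x = x \<otimes> s" if "s \<in> S" for s
    using commutes_generate[OF S _ comm[OF that] x] S that by blast
  then have "x \<otimes> y = y \<otimes> x"
    by (intro commutes_generate[OF S generate_in_carrier[OF S x] _ y]) (rule sym)
  then show "x \<otimes>\<^bsub>G\<lparr>carrier := generate G S\<rparr>\<^esub> y = y \<otimes>\<^bsub>G\<lparr>carrier := generate G S\<rparr>\<^esub> x"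
    by simp
qed

section \<open>Groups with a conjugation-invariant length that commutators contract\<close>

text \<open>Axiomatizes the behaviour of the distance to the identity matrix.
  \<open>len_pow_ge\<close> is informative only while \<open>real k * len x\<close> is below 1: in
  that range powers grow almost linearly, up to a quadratic error.\<close>

locale length_group = group G for G (structure) +
  fixes len :: "'a \<Rightarrow> real"
  assumes len_one [simp]: "len \<one> = 0"
    and len_eq_0: "x \<in> carrier G \<Longrightarrow> len x = 0 \<Longrightarrow> x = \<one>"
    and len_nonneg: "0 \<le> len x"
    and len_mult: "x \<in> carrier G \<Longrightarrow> y \<in> carrier G \<Longrightarrow> len (x \<otimes> y) \<le> len x + len y"
    and len_inv: "x \<in> carrier G \<Longrightarrow> len (inv x) = len x"
    and len_conj: "x \<in> carrier G \<Longrightarrow> y \<in> carrier G \<Longrightarrow> len (x \<otimes> y \<otimes> inv x) = len y"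
    and len_commutator: "x \<in> carrier G \<Longrightarrow> y \<in> carrier G \<Longrightarrow>
      len (x \<otimes> y \<otimes> inv x \<otimes> inv y) \<le> 2 * len x * len y"
    and len_pow_ge: "x \<in> carrier G \<Longrightarrow>
      real k * len x - (real k * len x)\<^sup>2 \<le> len (x [^] (k::nat))"
begin

lemma len_pow_le: "x \<in> carrier G \<Longrightarrow> len (x [^] (k::nat)) \<le> real k * len x"
proof (induction k)
  case (Suc k)
  then have "len (x [^] Suc k) \<le> len (x [^] k) + len x"
    by (simp add: len_mult)
  with Suc show ?case by (simp add: algebra_simps)
qed simp

text \<open>The bound is independent of \<open>x\<close>, so it survives replacing \<open>x\<close>
  by any power of itself.\<close>

lemma len_conj_inv_le:
  assumes "x \<in> carrier G" "y \<in> carrier G"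
  shows "len (x \<otimes> y \<otimes> inv x \<otimes> inv y) \<le> 2 * len y"
proof -
  have "len (x \<otimes> y \<otimes> inv x \<otimes> inv y) \<le> len (x \<otimes> y \<otimes> inv x) + len (inv y)"
    using assms by (intro len_mult) auto
  then show ?thesis using assms by (simp add: len_conj len_inv)
qed

text \<open>A nontrivial \<open>x\<close> moves away linearly: for \<open>k\<close> about
  \<open>1 / (2 * len x)\<close> the lower bound \<open>len_pow_ge\<close> is close to 1/4 and
  exceeds 1/8.\<close>

lemma no_small_cyclic_subgroup:
  assumes x: "x \<in> carrier G" and small: "\<And>k::nat. len (x [^] k) \<le> 1/8"
  shows "x = \<one>"
proof (rule ccontr)
  assume "x \<noteq> \<one>"
  define \<delta> where "\<delta> = len x"
  have \<delta>: "0 < \<delta>" "\<delta> \<le> 1/8"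
    using small[of 1] x len_eq_0 \<open>x \<noteq> \<one>\<close> len_nonneg[of x] by (auto simp: \<delta>_def less_le)
  define k where "k = nat \<lfloor>1 / (2 * \<delta>)\<rfloor>"
  have "real k \<le> 1 / (2 * \<delta>)" "1 / (2 * \<delta>) < real k + 1"
    using \<delta> by (simp_all add: k_def)
  then have b: "real k * \<delta> \<le> 1/2" "1/2 < real k * \<delta> + \<delta>"
    using \<delta> by (simp_all add: field_simps)
  \<comment> \<open>With \<open>t = real k * \<delta>\<close> in the interval from 3/8 to 1/2,
    expanding this product bounds \<open>t - t^2\<close> from below.\<close>
  then have "0 \<le> (1/2 - real k * \<delta>) * (real k * \<delta> - 3/8)"
    using \<delta> by (intro mult_nonneg_nonneg) auto
  then have "real k * \<delta> - (real k * \<delta>)\<^sup>2 \<ge> 3/16 + (real k * \<delta>) / 8"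
    by (simp add: algebra_simps power2_eq_square)
  then show False
    using len_pow_ge[OF x, of k] small[of k] b \<delta> by (auto simp: \<delta>_def)
qed

text \<open>Here \<open>z\<close> is the commutator of \<open>x\<close> and \<open>y\<close>,
  written without inverses. Each of the \<open>k\<close> copies of \<open>x\<close> that passes
  \<open>y\<close> leaves one \<open>z\<close>, which can be moved to the front because it commutes
  with \<open>x\<close>.\<close>

lemma pow_mult_central_commutator:
  assumes xyz: "x \<in> carrier G" "y \<in> carrier G" "z \<in> carrier G"
    and comm: "x \<otimes> y = z \<otimes> y \<otimes> x" "z \<otimes> x = x \<otimes> z"
  shows "x [^] (k::nat) \<otimes> y = z [^] k \<otimes> y \<otimes> x [^] k"
proof (induction k)
  case (Suc k)
  have zx: "x \<otimes> z [^] k = z [^] k \<otimes> x"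
    using group_commutes_pow[of z x k] xyz comm by simp
  have "x [^] Suc k \<otimes> y = x \<otimes> (x [^] k \<otimes> y)"
    using xyz nat_pow_Suc2[of x k] by (simp add: m_assoc del: nat_pow_Suc)
  also have "\<dots> = (x \<otimes> z [^] k) \<otimes> y \<otimes> x [^] k"
    using xyz by (simp add: Suc m_assoc)
  also have "\<dots> = z [^] k \<otimes> (x \<otimes> y) \<otimes> x [^] k"
    using xyz by (simp add: zx m_assoc)
  also have "\<dots> = (z [^] k \<otimes> z) \<otimes> y \<otimes> (x \<otimes> x [^] k)"
    using xyz by (simp add: comm m_assoc)
  finally show ?case
    using xyz nat_pow_Suc2[of x k] by simp
qed (use xyz in simp)

text \<open>If \<open>z = [x, y]\<close> commutes with \<open>x\<close>, then \<open>z\<^sup>k = [x\<^sup>k, y]\<close> stays close to the identity for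
  all \<open>k\<close>, so \<open>z\<close> is trivial.\<close>

lemma central_commutator_trivial:
  assumes xy: "x \<in> carrier G" "y \<in> carrier G" and small: "len y \<le> 1/16"
    and z: "z = x \<otimes> y \<otimes> inv x \<otimes> inv y" and comm: "z \<otimes> x = x \<otimes> z"
  shows "z = \<one>"
proof (rule no_small_cyclic_subgroup)
  show zG: "z \<in> carrier G" using xy z by simp
  have "z \<otimes> y \<otimes> x = x \<otimes> y"
    using xy by (simp add: z m_assoc)
  note * = pow_mult_central_commutator[OF xy zG this[symmetric] comm]
  show "len (z [^] k) \<le> 1/8" for k :: nat
  proof -
    have "x [^] k \<otimes> y \<otimes> inv (x [^] k) \<otimes> inv y = z [^] k"
      using xy zG by (simp add: * m_assoc)
    with len_conj_inv_le[of "x [^] k" y] xy small show ?thesis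
      by simp
  qed
qed

section \<open>Counting ordered products along a rapidly shrinking sequence\<close>

text \<open>The starting index \<open>k\<close> is a parameter so that inductions can split off the
  leading, longest factor.\<close>

primrec ordered_products :: "(nat \<Rightarrow> 'a) \<Rightarrow> nat \<Rightarrow> nat \<Rightarrow> nat \<Rightarrow> 'a set" where
  "ordered_products h M k 0 = {\<one>}"
| "ordered_products h M k (Suc m) =
     (\<lambda>(i, t). h k [^] i \<otimes> t) ` ({..<M} \<times> ordered_products h M (Suc k) m)"

lemma ordered_products_carrier:
  assumes "\<And>k. h k \<in> carrier G" and "t \<in> ordered_products h M k m"
  shows "t \<in> carrier G"
  using assms(2) by (induction m arbitrary: k t) (auto simp: assms(1))

text \<open>A geometric series: the leading power costs at most \<open>M * len (h k)\<close>, and by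
  the decay the tail costs no more than that again.\<close>

lemma len_ordered_products:
  assumes h: "\<And>k. h k \<in> carrier G" and decay: "\<And>k. 4 * len (h (Suc k)) \<le> len (h k)"
    and "t \<in> ordered_products h M k m"
  shows "len t \<le> 2 * real M * len (h k)"
  using assms(3)
proof (induction m arbitrary: k t)
  case 0
  then show ?case using len_nonneg by simp
next
  case (Suc m)
  then obtain i u where t: "t = h k [^] i \<otimes> u" and i: "i < M"
    and u: "u \<in> ordered_products h M (Suc k) m" by auto
  have "len t \<le> len (h k [^] i) + len u"
    unfolding t using h ordered_products_carrier[of h, OF h u] by (intro len_mult) auto
  also have "\<dots> \<le> real i * len (h k) + 2 * real M * len (h (Suc k))"
    using len_pow_le[OF h] Suc.IH[OF u] by (intro add_mono) auto
  also have "\<dots> \<le> real M * len (h k) + real M * len (h k)"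
  proof (intro add_mono)
    show "real i * len (h k) \<le> real M * len (h k)"
      using i len_nonneg by (intro mult_right_mono) auto
    have "real M * (2 * len (h (Suc k))) \<le> real M * len (h k)"
      using decay[of k] len_nonneg[of "h (Suc k)"] by (intro mult_left_mono) auto
    then show "2 * real M * len (h (Suc k)) \<le> real M * len (h k)" by simp
  qed
  finally show ?case by simp
qed

text \<open>If the leading exponents differed by \<open>n > 0\<close>, then \<open>h k [^] n\<close>
  would equal a quotient of two tails, of length at most \<open>len (h k) / 4\<close>. Since
  \<open>real n * len (h k)\<close> is at most 1/2, the quadratic error in \<open>len_pow_ge\<close>
  eats at most half, so this power has length at least \<open>len (h k) / 2\<close>.\<close>

lemma ordered_products_cancel:
  assumes h: "\<And>k. h k \<in> carrier G" and nontriv: "\<And>k. h k \<noteq> \<one>"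
    and M: "1 \<le> M"
    and small: "\<And>k. 2 * real M * len (h k) \<le> 1"
    and decay: "\<And>k. 16 * real M * len (h (Suc k)) \<le> len (h k)"
    and t: "t \<in> ordered_products h M (Suc k) m" and u: "u \<in> ordered_products h M (Suc k) m"
    and ij: "i \<le> j" "j < M" and eq: "h k [^] i \<otimes> t = h k [^] j \<otimes> u"
  shows "i = j"
proof (rule ccontr)
  assume "i \<noteq> j"
  have decay4: "4 * len (h (Suc k)) \<le> len (h k)" for k
  proof -
    have "4 * len (h (Suc k)) \<le> 16 * real M * len (h (Suc k))"
      using M len_nonneg by (intro mult_right_mono) auto
    with decay[of k] show ?thesis by linarith
  qed
  define n where "n = j - i"
  have n: "1 \<le> n" "n < M" "j = i + n" using ij \<open>i \<noteq> j\<close> by (auto simp: n_def)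
  have tG: "t \<in> carrier G" "u \<in> carrier G"
    using ordered_products_carrier[of h, OF h] t u by blast+
  have "h k [^] i \<otimes> t = h k [^] i \<otimes> (h k [^] n \<otimes> u)"
    using eq h tG by (simp add: n nat_pow_mult[symmetric] m_assoc)
  then have "t = h k [^] n \<otimes> u" using h tG by simp
  then have "h k [^] n = t \<otimes> inv u" using h tG by (simp add: m_assoc)
  then have "len (h k [^] n) \<le> len t + len u"
    using len_mult[of t "inv u"] tG by (simp add: len_inv)
  also have "\<dots> \<le> 4 * real M * len (h (Suc k))"
    using len_ordered_products[of h, OF h decay4 t] len_ordered_products[of h, OF h decay4 u] by simp
  also have "\<dots> \<le> len (h k) / 4" using decay[of k] by simp
  finally have up: "len (h k [^] n) \<le> len (h k) / 4" .
  have pos: "0 < len (h k)" using nontriv[of k] len_eq_0[OF h[of k]] len_nonneg[of "h k"]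
    by (auto simp: less_le)
  have a: "len (h k) \<le> real n * len (h k)" using n pos by simp
  have "real n * len (h k) \<le> real M * len (h k)" using n pos by simp
  then have "real n * len (h k) \<le> 1/2" using small[of k] by simp
  then have "(real n * len (h k)) * (real n * len (h k)) \<le> (real n * len (h k)) * (1/2)"
    using a pos by (intro mult_left_mono) auto
  then have "real n * len (h k) / 2 \<le> len (h k [^] n)"
    using len_pow_ge[OF h[of k], of n] by (simp add: power2_eq_square)
  with up a pos show False by linarith
qed

lemma card_ordered_products:
  assumes h: "\<And>k. h k \<in> carrier G" and nontriv: "\<And>k. h k \<noteq> \<one>"
    and M: "1 \<le> M"
    and small: "\<And>k. 2 * real M * len (h k) \<le> 1"
    and decay: "\<And>k. 16 * real M * len (h (Suc k)) \<le> len (h k)"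
  shows "card (ordered_products h M k m) = M ^ m"
proof (induction m arbitrary: k)
  case (Suc m)
  have "inj_on (\<lambda>(i, t). h k [^] i \<otimes> t) ({..<M} \<times> ordered_products h M (Suc k) m)"
  proof (clarsimp simp: inj_on_def)
    fix i t j u
    assume *: "t \<in> ordered_products h M (Suc k) m" "u \<in> ordered_products h M (Suc k) m"
      "i < M" "j < M" "h k [^] i \<otimes> t = h k [^] j \<otimes> u"
    note cancel = ordered_products_cancel[of h, OF assms]
    have "i = j"
      \<comment> \<open>Cancellation assumes ordered exponents, so it is applied in both
        orders.\<close>
      using cancel[OF *(1,2) _ *(4,5)] cancel[OF *(2,1) _ *(3) *(5)[symmetric]] by force
    then show "i = j \<and> t = u"
      using * h ordered_products_carrier[of h, OF h] by simp
  qed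
  then show ?case by (simp add: card_image card_cartesian_product Suc.IH)
qed simp

end

section \<open>Filtrations of polynomial growth and the commutator chain\<close>

text \<open>\<open>W r\<close> models the ball of word radius \<open>r\<close>. The bound uses
  \<open>Suc r\<close> because \<open>W 0\<close> is nonempty.\<close>

locale polynomial_filtration = length_group +
  fixes W :: "nat \<Rightarrow> 'a set" and C :: real and D :: nat
  assumes W_carrier: "W r \<subseteq> carrier G"
    and W_one: "\<one> \<in> W r"
    and W_mult: "x \<in> W r \<Longrightarrow> y \<in> W s \<Longrightarrow> x \<otimes> y \<in> W (r + s)"
    and W_inv: "x \<in> W r \<Longrightarrow> inv x \<in> W r"
    and W_finite: "finite (W r)"
    and W_card: "real (card (W r)) \<le> C * real (Suc r) ^ D"
begin

lemma W_mono: "r \<le> s \<Longrightarrow> W r \<subseteq> W s"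
  using W_mult[OF _ W_one, of _ r "s - r"] W_carrier[of r] by (auto simp: subset_iff)

lemma W_pow: "x \<in> W r \<Longrightarrow> x [^] (k::nat) \<in> W (k * r)"
  by (induction k) (auto simp: W_one intro: W_mult[of _ _ _ r] simp: add.commute[of r])

text \<open>A crude count: each of the \<open>m\<close> factors is a power below \<open>M\<close> of
  an element of radius at most \<open>L * 4 ^ (k + m)\<close>.\<close>

lemma ordered_products_W:
  assumes "\<And>k. h k \<in> W (L * 4 ^ k)" and "t \<in> ordered_products h M k m"
  shows "t \<in> W (M * m * L * 4 ^ (k + m))"
  using assms(2)
proof (induction m arbitrary: k t)
  case 0
  then show ?case by (simp add: W_one)
next
  case (Suc m)
  then obtain i u where t: "t = h k [^] i \<otimes> u" and i: "i < M"
    and u: "u \<in> ordered_products h M (Suc k) m" by auto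
  have "t \<in> W (i * (L * 4 ^ k) + M * m * L * 4 ^ (Suc k + m))"
    unfolding t by (intro W_mult W_pow assms(1) Suc.IH u)
  moreover have "i * (L * 4 ^ k) \<le> M * (L * 4 ^ (k + Suc m))"
    using i by (intro mult_mono power_increasing) auto
  then have "i * (L * 4 ^ k) + M * m * L * 4 ^ (Suc k + m) \<le> M * Suc m * L * 4 ^ (k + Suc m)"
    by (simp add: algebra_simps)
  ultimately show ?case using W_mono by blast
qed

lemma chain_growth_contradiction:
  fixes h :: "nat \<Rightarrow> 'a"
  assumes h: "\<And>k. h k \<in> W (L * 4 ^ k)" and nontriv: "\<And>k. h k \<noteq> \<one>"
    and small: "\<And>k. 4 * 4 ^ D * len (h k) \<le> 1"
    and decay: "\<And>k. 32 * 4 ^ D * len (h (Suc k)) \<le> len (h k)"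
  shows False
proof -
  \<comment> \<open>Chosen so that \<open>M ^ m\<close> is \<open>2 ^ m * (4 ^ m) ^ D\<close>: the
    second factor absorbs the exponential part of the word radius, and \<open>2 ^ m\<close> is left
    against a polynomial in \<open>m\<close>.\<close>
  define M :: nat where "M = 2 * 4 ^ D"
  have hG: "h k \<in> carrier G" for k using h W_carrier by blast
  define P where "P m = M * m * L * 4 ^ m" for m
  have bound: "2 ^ m \<le> \<bar>C\<bar> * (real (Suc (M * m * L))) ^ D" for m
  proof -
    have "real (M ^ m) = card (ordered_products h M 0 m)"
      using small decay by (subst card_ordered_products[of h, OF hG nontriv]) (auto simp: M_def)
    also have "\<dots> \<le> card (W (P m))"
      using ordered_products_W[of h, OF h, of _ M 0 m] W_finite
      by (auto intro!: card_mono simp: P_def)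
    also have "real (card (W (P m))) \<le> \<bar>C\<bar> * real (Suc (P m)) ^ D"
      by (rule order_trans[OF W_card]) (auto intro!: mult_right_mono)
    also have "\<dots> \<le> \<bar>C\<bar> * (real (Suc (M * m * L)) * 4 ^ m) ^ D"
      by (intro mult_left_mono power_mono) (auto simp: P_def algebra_simps)
    finally have "2 ^ m * (4 ^ m) ^ D \<le> \<bar>C\<bar> * real (Suc (M * m * L)) ^ D * (4 ^ m) ^ D"
      by (simp add: M_def power_mult_distrib power_mult[symmetric] mult.commute[of m D] mult_ac)
    then show ?thesis by (simp only: mult_le_cancel_right) simp
  qed
  have "eventually (\<lambda>m::nat. 2 ^ m > \<bar>C\<bar> * (1 + real M * real m * real L) ^ D) at_top"
  proof -
    have "eventually (\<lambda>m::nat. \<bar>C\<bar> * (1 + real M * real m * real L) ^ D \<le> 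
      \<bar>C\<bar> * (1 + real M * real L) ^ D * real m ^ D) at_top"
    proof (rule eventually_mono[OF eventually_ge_at_top[of 1]])
      fix m :: nat assume "1 \<le> m"
      then have "(1 + real M * real m * real L) ^ D \<le> ((1 + real M * real L) * real m) ^ D"
        by (intro power_mono) (auto simp: algebra_simps)
      then show "\<bar>C\<bar> * (1 + real M * real m * real L) ^ D \<le> 
        \<bar>C\<bar> * (1 + real M * real L) ^ D * real m ^ D"
        by (simp add: power_mult_distrib mult.assoc mult_left_mono)
    qed
    moreover have "eventually (\<lambda>m::nat. K * real m ^ D < 2 ^ m) at_top" for K
      by real_asymp
    ultimately show ?thesis by (rule eventually_elim2) (rule le_less_trans)
  qed
  then obtain m :: nat where "2 ^ m > \<bar>C\<bar> * (1 + real M * real m * real L) ^ D"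
    using eventually_happens'[OF sequentially_bot] by blast
  with bound[of m] show False by simp
qed

theorem small_elements_commute:
  assumes S: "S \<subseteq> W L" and small: "\<And>s. s \<in> S \<Longrightarrow> 64 * 4 ^ D * len s \<le> 1"
    and ab: "a \<in> S" "b \<in> S"
  shows "a \<otimes> b = b \<otimes> a"
proof (rule ccontr)
  assume "a \<otimes> b \<noteq> b \<otimes> a"
  define c where "c x y = x \<otimes> y \<otimes> inv x \<otimes> inv y" for x y
  have SG: "s \<in> carrier G" if "s \<in> S" for s using that S W_carrier by blast
  define central where "central x \<longleftrightarrow> (\<forall>s\<in>S. x \<otimes> s = s \<otimes> x)" for x
  have central_gen: "x \<otimes> y = y \<otimes> x"
    if "central x" "x \<in> carrier G" "y \<in> generate G S" for x y
    using commutes_generate[of S x y] that SG by (auto simp: central_def)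
  \<comment> \<open>The invariant of the chain. Membership in \<open>generate G S\<close> ensures
    that elements centralizing \<open>S\<close> also commute with \<open>x\<close>.\<close>
  define P where "P k x \<longleftrightarrow> x \<in> W (L * 4 ^ k) \<and> x \<in> generate G S
    \<and> 64 * 4 ^ D * len x \<le> 1 \<and> \<not> central x" for k x
  have "P 0 a"
    using ab S small \<open>a \<otimes> b \<noteq> b \<otimes> a\<close> by (auto simp: P_def central_def intro: generate.incl)
  moreover have "\<exists>y. P (Suc k) y \<and> 32 * 4 ^ D * len y \<le> len x" if "P k x" for k x
  proof -
    have x: "x \<in> W (L * 4 ^ k)" "x \<in> generate G S" "64 * 4 ^ D * len x \<le> 1" "\<not> central x"
      using that by (auto simp: P_def)
    have xG: "x \<in> carrier G" using x W_carrier by blast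
    \<comment> \<open>Otherwise every \<open>c x s\<close> commutes with \<open>x\<close>, hence is
      trivial by \<open>central_commutator_trivial\<close>, and \<open>x\<close> itself centralizes
      \<open>S\<close>.\<close>
    have "\<exists>s\<in>S. \<not> central (c x s)"
    proof (rule ccontr)
      assume "\<not> ?thesis"
      then have cent: "central (c x s)" if "s \<in> S" for s using that by blast
      have "central x" unfolding central_def
      proof
        fix s assume s: "s \<in> S"
        have "1 * len s \<le> 4 * 4 ^ D * len s"
          by (intro mult_right_mono len_nonneg) (use one_le_power[of "4::real" D] in linarith)
        then have "len s \<le> 1/16" using small[OF s] by simp
        then have "c x s = \<one>"
          using central_commutator_trivial[OF xG SG[OF s] _ c_def] SG[OF s] xG
            central_gen[OF cent[OF s] _ x(2)] by (auto simp: c_def)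
        then have "c x s \<otimes> s \<otimes> x = s \<otimes> x" using xG SG[OF s] by simp
        then show "x \<otimes> s = s \<otimes> x" using xG SG[OF s] by (simp add: c_def m_assoc)
      qed
      with x show False by blast
    qed
    then obtain s where s: "s \<in> S" "\<not> central (c x s)" by blast
    have sG: "s \<in> carrier G" using SG s by blast
    have sW: "s \<in> W L" using s S by blast
    have gS: "generate G S \<subseteq> carrier G" "subgroup (generate G S) G"
      using SG by (auto intro: generate_in_carrier generate_is_subgroup)
    \<comment> \<open>The commutator uses \<open>x\<close> and \<open>s\<close> twice each, so its
      radius at most quadruples; this is the origin of \<open>4 ^ k\<close>.\<close>
    have "c x s \<in> W (L * 4 ^ k + L + L * 4 ^ k + L)"
      unfolding c_def using x sW by (intro W_mult W_inv)
    moreover have "L * 4 ^ k + L + L * 4 ^ k + L \<le> L * 4 ^ Suc k"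
    proof -
      have "L * 1 \<le> L * 4 ^ k" by (intro mult_left_mono) auto
      then show ?thesis by (simp only: power_Suc mult.left_commute[of L])
    qed
    ultimately have cW: "c x s \<in> W (L * 4 ^ Suc k)" using W_mono by blast
    have "c x s \<in> generate G S"
      unfolding c_def using x s gS
      by (intro subgroup.m_closed[OF gS(2)] subgroup.m_inv_closed[OF gS(2)]) (auto intro: generate.incl)
    \<comment> \<open>The factor 2 in \<open>len_commutator\<close> turns the decay rate 32 into the
      smallness constant 64 required of \<open>S\<close>.\<close>
    moreover have *: "32 * 4 ^ D * len (c x s) \<le> len x"
    proof -
      have "32 * 4 ^ D * len (c x s) \<le> 32 * 4 ^ D * (2 * len x * len s)"
        unfolding c_def by (intro mult_left_mono len_commutator xG sG) auto
      also have "\<dots> = (64 * 4 ^ D * len s) * len x" by simp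
      also have "\<dots> \<le> 1 * len x"
        by (intro mult_right_mono small s len_nonneg)
      finally show ?thesis by simp
    qed
    moreover have "len (c x s) \<le> len x"
    proof -
      have "1 * len (c x s) \<le> 32 * 4 ^ D * len (c x s)"
        by (intro mult_right_mono len_nonneg) (use one_le_power[of "4::real" D] in linarith)
      with * show ?thesis by linarith
    qed
    then have "64 * 4 ^ D * len (c x s) \<le> 64 * 4 ^ D * len x" by (intro mult_left_mono) auto
    ultimately have "P (Suc k) (c x s)" using cW s(2) x(3) unfolding P_def by linarith
    with * show ?thesis by blast
  qed
  ultimately have "\<exists>h. \<forall>k. P k (h k) \<and> 32 * 4 ^ D * len (h (Suc k)) \<le> len (h k)"
    by (intro dependent_nat_choice) blast+
  then obtain h where h: "\<And>k. P k (h k)" "\<And>k. 32 * 4 ^ D * len (h (Suc k)) \<le> len (h k)"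
    by blast
  have "4 * 4 ^ D * len (h k) \<le> 1" for k
  proof -
    have "4 * 4 ^ D * len (h k) \<le> 64 * 4 ^ D * len (h k)"
      using len_nonneg by (intro mult_right_mono) auto
    with h(1)[of k] show ?thesis by (simp add: P_def)
  qed
  \<comment> \<open>The identity centralizes \<open>S\<close>, whereas no member of the chain
    does.\<close>
  moreover have "h k \<noteq> \<one>" for k
    using h(1)[of k] SG by (auto simp: P_def central_def)
  ultimately show False
    using h by (intro chain_growth_contradiction[of h L]) (auto simp: P_def)
qed

end

section \<open>Powers of a symmetric generating set\<close>

context group
begin

lemma set_pow_carrier: "S \<subseteq> carrier G \<Longrightarrow> set_pow G S r \<subseteq> carrier G"
  by (induction r) (auto simp: set_mult_def)

lemma set_pow_mult:
  assumes "S \<subseteq> carrier G" "x \<in> set_pow G S i" "y \<in> set_pow G S j"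
  shows "x \<otimes> y \<in> set_pow G S (i + j)"
  using assms(3)
proof (induction j arbitrary: y)
  case 0
  then show ?case using assms set_pow_carrier[OF assms(1), of i] by auto
next
  case (Suc j)
  then obtain z s where "y = z \<otimes> s" "z \<in> set_pow G S j" "s \<in> S"
    by (auto simp: set_mult_def)
  moreover from this have "x \<otimes> (z \<otimes> s) = (x \<otimes> z) \<otimes> s"
    using set_pow_carrier[OF assms(1)] assms(1,2) by (intro m_assoc[symmetric]) auto
  ultimately show ?case using Suc.IH by (auto simp: set_mult_def)
qed

lemma set_pow_1: "S \<subseteq> carrier G \<Longrightarrow> set_pow G S 1 = S"
  by (force simp: set_mult_def subset_iff cong: bex_cong)

lemma set_pow_inv:
  assumes S: "S \<subseteq> carrier G" and sym: "\<And>s. s \<in> S \<Longrightarrow> inv s \<in> S"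
    and "x \<in> set_pow G S r"
  shows "inv x \<in> set_pow G S r"
  using assms(3)
proof (induction r arbitrary: x)
  case (Suc r)
  then obtain y s where x: "x = y \<otimes> s" "y \<in> set_pow G S r" "s \<in> S"
    by (auto simp: set_mult_def)
  then have "inv x = inv s \<otimes> inv y"
    using set_pow_carrier[OF S] S by (auto intro: inv_mult_group)
  moreover have "inv s \<in> set_pow G S 1" using set_pow_1[OF S] sym x by simp
  ultimately show ?case
    using set_pow_mult[OF S, of "inv s" 1 "inv y" r] Suc.IH[OF x(2)] by (simp only: plus_1_eq_Suc)
qed simp

lemma finite_set_pow: "finite S \<Longrightarrow> finite (set_pow G S r)"
  by (induction r) (auto simp: set_mult_def)

lemma generate_subset_set_pow:
  assumes S: "S \<subseteq> carrier G" and sym: "\<And>s. s \<in> S \<Longrightarrow> inv s \<in> S"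
    and "x \<in> generate G S"
  shows "\<exists>r. x \<in> set_pow G S r"
  using assms(3)
proof (induction rule: generate.induct)
  case one
  then show ?case by (intro exI[of _ 0]) simp
next
  case (incl h)
  then show ?case using set_pow_1[OF S] by blast
next
  case (inv h)
  then show ?case using set_pow_1[OF S] sym by blast
next
  case (eng h1 h2)
  then show ?case using set_pow_mult[OF S] by blast
qed

end

text \<open>Products of exactly \<open>r\<close> generators need not be nested in \<open>r\<close>,
  so balls are unions over \<open>j \<le> r\<close>; summing \<open>r + 1\<close> bounds raises the
  degree by one. Absolute values allow for \<open>B\<close> and \<open>d\<close> of any
  sign.\<close>

lemma polynomial_filtration_set_pow:
  assumes "length_group G len"
    and S: "S \<subseteq> carrier G" "finite S" and sym: "\<And>s. s \<in> S \<Longrightarrow> inv\<^bsub>G\<^esub> s \<in> S"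
    and growth: "\<And>r. 1 \<le> r \<Longrightarrow> real (card (set_pow G S r)) \<le> B * real r powr d"
  shows "polynomial_filtration G len (\<lambda>r. \<Union>j\<le>r. set_pow G S j) (\<bar>B\<bar> + 1) (Suc (nat \<lceil>\<bar>d\<bar>\<rceil>))"
proof -
  interpret length_group G len by fact
  define D where "D = nat \<lceil>\<bar>d\<bar>\<rceil>"
  have card1: "real (card (set_pow G S j)) \<le> (\<bar>B\<bar> + 1) * real (Suc r) ^ D" if "j \<le> r" for j r
  proof (cases "j = 0")
    case True
    have "1 * 1 \<le> (\<bar>B\<bar> + 1) * real (Suc r) ^ D"
      by (intro mult_mono one_le_power) auto
    with True show ?thesis by simp
  next
    case False
    have "real j powr d \<le> real j powr real D"
      using False by (intro powr_mono) (auto simp: D_def, linarith)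
    also have "\<dots> = real j ^ D" using False by (simp add: powr_realpow)
    also have "\<dots> \<le> real (Suc r) ^ D" using that by (intro power_mono) auto
    finally have le: "\<bar>B\<bar> * real j powr d \<le> (\<bar>B\<bar> + 1) * real (Suc r) ^ D"
      by (intro mult_mono) auto
    have "B * real j powr d \<le> \<bar>B\<bar> * real j powr d"
      by (intro mult_right_mono) auto
    then show ?thesis using growth[of j] False le by linarith
  qed
  show ?thesis
  proof (unfold_locales, goal_cases)
    case (1 r)
    then show ?case using set_pow_carrier[OF S(1)] by blast
  next
    case (2 r)
    then show ?case by (intro UN_I[of 0]) auto
  next
    case (3 x r y s)
    then obtain i j where "i \<le> r" "x \<in> set_pow G S i" "j \<le> s" "y \<in> set_pow G S j" by auto
    then show ?case using set_pow_mult[OF S(1), of x i y j] by (intro UN_I[of "i + j"]) auto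
  next
    case (4 x r)
    then show ?case using set_pow_inv[OF S(1) sym] by blast
  next
    case (5 r)
    then show ?case using finite_set_pow[OF S(2)] by blast
  next
    case (6 r)
    have "real (card (\<Union>j\<le>r. set_pow G S j)) \<le> (\<Sum>j\<le>r. real (card (set_pow G S j)))"
      using card_UN_le[of "{..r}" "set_pow G S"] by (simp flip: of_nat_sum)
    also have "\<dots> \<le> (\<Sum>j\<le>r. (\<bar>B\<bar> + 1) * real (Suc r) ^ D)"
      by (intro sum_mono card1) auto
    also have "\<dots> = (\<bar>B\<bar> + 1) * real (Suc r) ^ Suc D" by simp
    finally show ?case by (simp add: D_def)
  qed
qed

lemma matrix_diff_ldistrib: "A ** (B - C) = A ** B - A ** (C :: 'a::ring_1^'n^'m)"
  by (simp add: matrix_matrix_mult_def vec_eq_iff right_diff_distrib sum_subtractf)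

lemma matrix_diff_rdistrib: "(B - C) ** A = B ** A - C ** (A :: 'a::ring_1^'n^'m)"
  by (simp add: matrix_matrix_mult_def vec_eq_iff left_diff_distrib sum_subtractf)

lemma matrix_add_rdistrib: "(B + C) ** A = B ** A + C ** (A :: 'a::semiring_1^'n^'m)"
  by (simp add: matrix_matrix_mult_def vec_eq_iff distrib_right sum.distrib)

lemma norm_matrix_power2:
  fixes A :: "complex^'n^'m"
  shows "(norm A)\<^sup>2 = (\<Sum>i\<in>UNIV. \<Sum>j\<in>UNIV. (cmod (A $ i $ j))\<^sup>2)"
  by (simp add: norm_vec_def L2_set_def sum_nonneg)

lemma norm_conj_transpose [simp]: "norm (conj_transpose A) = norm (A :: complex^'n^'m)"
proof -
  have "(norm (conj_transpose A))\<^sup>2 = (norm A)\<^sup>2"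
    unfolding norm_matrix_power2 by (subst sum.swap) (simp add: conj_transpose_def)
  then show ?thesis by simp
qed

lemma norm_matrix_mult:
  fixes A :: "complex^'n^'m" and B :: "complex^'k^'n"
  shows "norm (A ** B) \<le> norm A * norm B"
proof -
  have entry: "(cmod ((A ** B) $ i $ j))\<^sup>2
      \<le> (\<Sum>l\<in>UNIV. (cmod (A $ i $ l))\<^sup>2) * (\<Sum>l\<in>UNIV. (cmod (B $ l $ j))\<^sup>2)" for i j
  proof -
    have "cmod ((A ** B) $ i $ j) \<le> (\<Sum>l\<in>UNIV. \<bar>cmod (A $ i $ l)\<bar> * \<bar>cmod (B $ l $ j)\<bar>)"
      by (auto simp: matrix_matrix_mult_def norm_mult intro!: order_trans[OF norm_sum])
    also have "\<dots> \<le> L2_set (\<lambda>l. cmod (A $ i $ l)) UNIV * L2_set (\<lambda>l. cmod (B $ l $ j)) UNIV"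
      by (rule L2_set_mult_ineq)
    finally have "(cmod ((A ** B) $ i $ j))\<^sup>2
        \<le> (L2_set (\<lambda>l. cmod (A $ i $ l)) UNIV * L2_set (\<lambda>l. cmod (B $ l $ j)) UNIV)\<^sup>2"
      by (intro power_mono) auto
    then show ?thesis by (simp add: power_mult_distrib L2_set_def sum_nonneg)
  qed
  have "(norm (A ** B))\<^sup>2 \<le> (\<Sum>i\<in>UNIV. \<Sum>j\<in>UNIV.
      (\<Sum>l\<in>UNIV. (cmod (A $ i $ l))\<^sup>2) * (\<Sum>l\<in>UNIV. (cmod (B $ l $ j))\<^sup>2))"
    unfolding norm_matrix_power2 by (intro sum_mono entry)
  also have "\<dots> = (norm A)\<^sup>2 * (\<Sum>j\<in>UNIV. \<Sum>l\<in>UNIV. (cmod (B $ l $ j))\<^sup>2)"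
    by (simp add: norm_matrix_power2 sum_product)
  also have "(\<Sum>j\<in>UNIV. \<Sum>l\<in>UNIV. (cmod (B $ l $ j))\<^sup>2) = (norm B)\<^sup>2"
    unfolding norm_matrix_power2 by (rule sum.swap)
  finally have "(norm (A ** B))\<^sup>2 \<le> (norm A * norm B)\<^sup>2"
    by (simp only: power_mult_distrib)
  then show ?thesis by (rule power2_le_imp_le) simp
qed

lemma norm_matrix_trace:
  fixes A :: "complex^'n^'m"
  shows "complex_of_real ((norm A)\<^sup>2) = trace (conj_transpose A ** A)"
  unfolding norm_matrix_power2 trace_def
  by (subst sum.swap) (simp add: conj_transpose_def matrix_matrix_mult_def complex_norm_square mult.commute del: of_real_power)

lemma norm_unitary_mult_left:
  fixes A :: "complex^'n^'n"
  assumes "U \<in> carrier unitary_group"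
  shows "norm (U ** A) = norm A"
proof -
  have "conj_transpose (U ** A) ** (U ** A) = conj_transpose A ** (conj_transpose U ** U) ** A"
    by (simp add: conj_transpose_mult matrix_mul_assoc)
  also have "\<dots> = conj_transpose A ** A"
    using assms by (simp add: unitary_group_def)
  finally have "complex_of_real ((norm (U ** A))\<^sup>2) = complex_of_real ((norm A)\<^sup>2)"
    by (simp only: norm_matrix_trace)
  then show ?thesis by (simp only: of_real_eq_iff) simp
qed

lemma conj_transpose_unitary:
  "U \<in> carrier unitary_group \<Longrightarrow> conj_transpose U \<in> carrier unitary_group"
  by (simp add: unitary_group_def)

lemma norm_unitary_mult_right:
  fixes A :: "complex^'n^'n"
  assumes "U \<in> carrier unitary_group"
  shows "norm (A ** U) = norm A"
proof -
  have "norm (A ** U) = norm (conj_transpose U ** conj_transpose A)"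
    by (simp flip: conj_transpose_mult)
  then show ?thesis by (simp add: norm_unitary_mult_left conj_transpose_unitary assms)
qed

lemma unitary_group_sel [simp]:
  "x \<otimes>\<^bsub>unitary_group\<^esub> y = x ** y" "\<one>\<^bsub>unitary_group\<^esub> = mat 1"
  by (simp_all add: unitary_group_def)

lemma unitary_cancel [simp]:
  assumes "U \<in> carrier unitary_group"
  shows "U ** conj_transpose U = mat 1" "conj_transpose U ** U = mat 1"
    "A ** U ** conj_transpose U = A" "A ** conj_transpose U ** U = A"
  using assms by (simp_all add: unitary_group_def flip: matrix_mul_assoc)

lemma inv_unitary_group:
  assumes "U \<in> carrier unitary_group"
  shows "inv\<^bsub>unitary_group\<^esub> U = conj_transpose U"
  using assms by (intro group.inv_equality[OF group_unitary_group]) (auto simp: conj_transpose_unitary)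

lemma norm_unitary_pow:
  fixes U :: "complex^'n^'n"
  assumes "U \<in> carrier unitary_group"
  shows "norm (U [^]\<^bsub>unitary_group\<^esub> (k::nat) - mat 1) \<le> real k * norm (U - mat 1)
    \<and> norm (U [^]\<^bsub>unitary_group\<^esub> k - mat 1 - real k *\<^sub>R (U - mat 1)) \<le> (real k * norm (U - mat 1))\<^sup>2"
proof (induction k)
  case (Suc k)
  let ?P = "U [^]\<^bsub>unitary_group\<^esub> k" and ?\<delta> = "norm (U - mat 1)"
  have P: "U [^]\<^bsub>unitary_group\<^esub> Suc k = ?P ** U"
    by (simp add: nat_pow_def)
  have "?P ** U - mat 1 = (?P - mat 1) ** U + (U - mat 1)"
    by (simp add: matrix_diff_rdistrib)
  then have "norm (?P ** U - mat 1) \<le> norm ((?P - mat 1) ** U) + ?\<delta>"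
    by (metis norm_triangle_ineq)
  then have "norm (?P ** U - mat 1) \<le> norm (?P - mat 1) + ?\<delta>"
    by (simp add: norm_unitary_mult_right assms)
  then have 1: "norm (?P ** U - mat 1) \<le> real (Suc k) * ?\<delta>"
    using Suc by (simp add: algebra_simps)
  have "?P ** U - mat 1 - real (Suc k) *\<^sub>R (U - mat 1)
      = (?P - mat 1 - real k *\<^sub>R (U - mat 1)) + (?P - mat 1) ** (U - mat 1)"
    by (simp add: matrix_diff_rdistrib matrix_diff_ldistrib algebra_simps)
  then have "norm (?P ** U - mat 1 - real (Suc k) *\<^sub>R (U - mat 1))
      \<le> norm (?P - mat 1 - real k *\<^sub>R (U - mat 1)) + norm ((?P - mat 1) ** (U - mat 1))"
    by (metis norm_triangle_ineq)
  also have "\<dots> \<le> norm (?P - mat 1 - real k *\<^sub>R (U - mat 1)) + norm (?P - mat 1) * ?\<delta>"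
    by (intro add_left_mono norm_matrix_mult)
  also have "\<dots> \<le> (real k * ?\<delta>)\<^sup>2 + (real k * ?\<delta>) * ?\<delta>"
    using Suc by (intro add_mono mult_right_mono) auto
  also have "\<dots> \<le> (real (Suc k) * ?\<delta>)\<^sup>2"
    by (simp add: power2_eq_square algebra_simps)
  finally show ?case using 1 by (simp add: P)
qed simp

lemma length_group_unitary_group:
  "length_group (unitary_group :: (complex^'n^'n) monoid) (\<lambda>U. norm (U - mat 1))"
proof -
  interpret group "unitary_group :: (complex^'n^'n) monoid" by (rule group_unitary_group)
  show ?thesis
  proof (unfold_locales, goal_cases)
    case (4 x y)
    have "x ** y - mat 1 = (x - mat 1) ** y + (y - mat 1)"
      by (simp add: matrix_diff_rdistrib)
    then have "norm (x ** y - mat 1) \<le> norm ((x - mat 1) ** y) + norm (y - mat 1)"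
      by (metis norm_triangle_ineq)
    then show ?case using 4 by (simp add: norm_unitary_mult_right)
  next
    case (5 x)
    have "conj_transpose (x - mat 1) = conj_transpose x - mat 1"
      by (simp add: conj_transpose_def mat_def vec_eq_iff)
    then show ?case using norm_conj_transpose[of "x - mat 1"] 5 by (simp add: inv_unitary_group)
  next
    case (6 x y)
    have "x ** y ** conj_transpose x - mat 1 = x ** (y - mat 1) ** conj_transpose x"
      using 6 by (simp add: matrix_diff_rdistrib matrix_diff_ldistrib)
    then show ?case
      using 6 by (simp add: inv_unitary_group norm_unitary_mult_right norm_unitary_mult_left conj_transpose_unitary)
  next
    case (7 x y)
    let ?a = "x - mat 1" and ?b = "y - mat 1"
    have "x ** y ** conj_transpose x ** conj_transpose y - mat 1
        = (x ** y - y ** x) ** conj_transpose x ** conj_transpose y"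
      using 7 by (simp add: matrix_diff_rdistrib)
    then have "norm (x ** y ** conj_transpose x ** conj_transpose y - mat 1) = norm (x ** y - y ** x)"
      using 7 by (simp add: norm_unitary_mult_right conj_transpose_unitary)
    also have "x ** y - y ** x = ?a ** ?b - ?b ** ?a"
      by (simp add: matrix_diff_rdistrib matrix_diff_ldistrib)
    also have "norm (?a ** ?b - ?b ** ?a) \<le> norm (?a ** ?b) + norm (?b ** ?a)"
      by (rule norm_triangle_ineq4)
    also have "\<dots> \<le> 2 * norm ?a * norm ?b"
      using norm_matrix_mult[of ?a ?b] norm_matrix_mult[of ?b ?a] by (simp add: mult.commute[of "norm ?b"])
    finally show ?case using 7 by (simp add: inv_unitary_group)
  next
    case (8 x k)
    have "norm (real k *\<^sub>R (x - mat 1)) - norm (x [^]\<^bsub>unitary_group\<^esub> k - mat 1)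
        \<le> norm (x [^]\<^bsub>unitary_group\<^esub> k - mat 1 - real k *\<^sub>R (x - mat 1))"
      by (metis norm_minus_commute norm_triangle_ineq2)
    then show ?case using norm_unitary_pow[OF 8, of k] by simp
  qed auto
qed

lemma bounded_unitary_group: "bounded (carrier (unitary_group :: (complex^'n^'n) monoid))"
proof (rule boundedI)
  fix U :: "complex^'n^'n" assume "U \<in> carrier unitary_group"
  then show "norm U \<le> norm (mat 1 :: complex^'n^'n)"
    using norm_unitary_mult_left[of U "mat 1"] by simp
qed

lemma finite_rcosets_unitary:
  fixes G :: "(complex^'n^'n) set"
  assumes G: "subgroup G unitary_group" and H: "subgroup H unitary_group" "H \<subseteq> G"
    and "0 < \<epsilon>" and small: "\<And>g. g \<in> G \<Longrightarrow> norm (g - mat 1) \<le> \<epsilon> \<Longrightarrow> g \<in> H"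
  shows "finite (rcosets\<^bsub>unitary_group\<lparr>carrier := G\<rparr>\<^esub> H)"
proof -
  interpret U: group "unitary_group :: (complex^'n^'n) monoid" by (rule group_unitary_group)
  have GU: "g \<in> carrier unitary_group" if "g \<in> G" for g
    using that subgroup.mem_carrier[OF G] by blast
  have "bounded G" using bounded_unitary_group subgroup.subset[OF G] by (rule bounded_subset)
  then have "compact (closure G)" by simp
  then obtain T where T: "finite T" "closure G \<subseteq> (\<Union>t\<in>T. ball t (\<epsilon>/2))"
    using \<open>0 < \<epsilon>\<close> unfolding compact_eq_totally_bounded by (meson half_gt_zero)
  have "\<exists>t\<in>T. g \<in> ball t (\<epsilon>/2)" if "g \<in> G" for g
    using T that closure_subset by blast
  then obtain f where f: "\<And>g. g \<in> G \<Longrightarrow> f g \<in> T \<and> g \<in> ball (f g) (\<epsilon>/2)" by metis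
  have same: "H #>\<^bsub>unitary_group\<^esub> a = H #>\<^bsub>unitary_group\<^esub> b" if ab: "a \<in> G" "b \<in> G" "f a = f b" for a b
  proof -
    have "dist a b < \<epsilon>"
      using f[OF ab(1)] f[OF ab(2)] ab(3) by (auto intro: dist_triangle_half_r)
    moreover have "norm (a ** conj_transpose b - mat 1) = norm ((a - b) ** conj_transpose b)"
      using GU[OF ab(2)] by (simp add: matrix_diff_rdistrib)
    ultimately have "norm (a ** conj_transpose b - mat 1) \<le> \<epsilon>"
      using GU[OF ab(2)] by (simp add: norm_unitary_mult_right conj_transpose_unitary dist_norm)
    moreover have "a ** conj_transpose b \<in> G"
      using subgroup.m_closed[OF G ab(1) subgroup.m_inv_closed[OF G ab(2)]] GU[OF ab(2)]
      by (simp add: inv_unitary_group)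
    ultimately have "a ** conj_transpose b \<in> H" by (rule small[rotated])
    moreover have "a = a ** conj_transpose b \<otimes>\<^bsub>unitary_group\<^esub> b"
      using GU[OF ab(2)] by simp
    ultimately have "a \<in> H #>\<^bsub>unitary_group\<^esub> b" unfolding r_coset_def by blast
    then show ?thesis using U.repr_independence[OF _ GU[OF ab(2)] H(1)] by simp
  qed
  define g where "g t = (SOME a. a \<in> G \<and> f a = t)" for t
  have "(\<lambda>a. H #>\<^bsub>unitary_group\<^esub> a) ` G \<subseteq> (\<lambda>t. H #>\<^bsub>unitary_group\<^esub> g t) ` T"
  proof
    fix Y assume "Y \<in> (\<lambda>a. H #>\<^bsub>unitary_group\<^esub> a) ` G"
    then obtain a where a: "a \<in> G" "Y = H #>\<^bsub>unitary_group\<^esub> a" by blast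
    then have "\<exists>b. b \<in> G \<and> f b = f a" by blast
    then have "g (f a) \<in> G \<and> f (g (f a)) = f a"
      unfolding g_def by (rule someI_ex)
    then have "Y = H #>\<^bsub>unitary_group\<^esub> g (f a)"
      using same[of a "g (f a)"] a by (simp only:)
    then show "Y \<in> (\<lambda>t. H #>\<^bsub>unitary_group\<^esub> g t) ` T" using f a by blast
  qed
  then have "finite ((\<lambda>a. H #>\<^bsub>unitary_group\<^esub> a) ` G)"
    using T(1) by (meson finite_imageI finite_subset)
  moreover have "rcosets\<^bsub>unitary_group\<lparr>carrier := G\<rparr>\<^esub> H = (\<lambda>a. H #>\<^bsub>unitary_group\<^esub> a) ` G"
    by (auto simp: RCOSETS_def r_coset_def)
  ultimately show ?thesis by simp
qed

lemma matrix_commute_span: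
  fixes A :: "complex^'n^'n"
  assumes "B \<in> span S" and "\<And>s. s \<in> S \<Longrightarrow> A ** s = s ** A"
  shows "A ** B = B ** A"
  using assms(1)
proof (induction rule: span_induct)
  case base
  show ?case unfolding subspace_def
    by (auto simp: matrix_add_ldistrib matrix_add_rdistrib matrix_scalar_ac simp flip: scalar_matrix_assoc)
qed (use assms in auto)

theorem proposition5p1:
  fixes G :: "(complex^'n^'n) set"
  assumes "subgroup G unitary_group"
    and "finitely_generated (unitary_group\<lparr>carrier := G\<rparr>)"
    and "polynomial_growth (unitary_group\<lparr>carrier := G\<rparr>)"
  shows "virtually_abelian (unitary_group\<lparr>carrier := G\<rparr>)"
proof -
  let ?U = "unitary_group :: (complex^'n^'n) monoid" and ?G = "unitary_group\<lparr>carrier := G\<rparr>"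
  interpret U: group ?U by (rule group_unitary_group)
  note G = \<open>subgroup G unitary_group\<close>
  obtain d where "polynomial_growth_exponent ?G d"
    using assms(3) unfolding polynomial_growth_def by blast
  then obtain Q B where Q: "finite Q" "Q \<subseteq> carrier ?G" "\<forall>s\<in>Q. inv\<^bsub>?G\<^esub> s \<in> Q"
    "generate ?G Q = carrier ?G" and growth: "\<forall>r\<ge>1. real (card (set_pow ?G Q r)) \<le> B * real r powr d"
    unfolding polynomial_growth_exponent_def by blast
  have QG: "Q \<subseteq> G" using Q(2) by simp
  have pow_eq: "set_pow ?G Q r = set_pow ?U Q r" for r
    by (induction r) (simp_all add: set_mult_def)
  have gen: "generate ?U Q = G"
    using Q(4) U.generate_consistent[OF QG G] by simp
  have sym: "inv\<^bsub>?U\<^esub> s \<in> Q" if "s \<in> Q" for s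
    using Q(3) U.m_inv_consistent[OF G] QG that by (metis subsetD)
  have QU: "Q \<subseteq> carrier ?U" using QG subgroup.subset[OF G] by blast
  define D where "D = Suc (nat \<lceil>\<bar>d\<bar>\<rceil>)"
  define W where "W r = (\<Union>j\<le>r. set_pow ?U Q j)" for r
  interpret polynomial_filtration ?U "\<lambda>g. norm (g - mat 1)" W "\<bar>B\<bar> + 1" D
    unfolding W_def D_def
    by (rule polynomial_filtration_set_pow[OF length_group_unitary_group QU Q(1) sym])
      (use growth in \<open>auto simp: pow_eq\<close>)
  define \<epsilon> :: real where "\<epsilon> = 1 / (64 * 4 ^ D)"
  define E where "E = {g \<in> G. norm (g - mat 1) \<le> \<epsilon>}"
  define H where "H = generate ?U E"
  have EU: "E \<subseteq> carrier ?U" using subgroup.subset[OF G] by (auto simp: E_def)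
  obtain S where S: "S \<subseteq> E" "independent S" "E \<subseteq> span S"
    by (rule basis_exists[of E]) (rule that)
  have "\<exists>r. s \<in> W r" if "s \<in> S" for s
  proof -
    have "s \<in> generate ?U Q" using that S(1) gen by (auto simp: E_def)
    then obtain r where "s \<in> set_pow ?U Q r"
      using U.generate_subset_set_pow[OF QU sym] by blast
    then show ?thesis by (auto simp: W_def)
  qed
  then obtain l where l: "\<And>s. s \<in> S \<Longrightarrow> s \<in> W (l s)" by metis
  have "finite S" using S(2) by (rule independent_imp_finite)
  then have "W (l s) \<subseteq> W (Max (l ` S))" if "s \<in> S" for s
    using that by (intro W_mono Max_ge) auto
  then have SW: "S \<subseteq> W (Max (l ` S))" using l by blast
  have "64 * 4 ^ D * norm (s - mat 1) \<le> 1" if "s \<in> S" for s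
    using that S(1) by (auto simp: E_def \<epsilon>_def field_simps)
  from small_elements_commute[OF SW this] have S_comm: "a ** b = b ** a" if "a \<in> S" "b \<in> S" for a b
    using that by simp
  have "a ** s = s ** a" if "a \<in> E" "s \<in> S" for a s
    using matrix_commute_span[of a S s] S_comm that S(3) by auto
  then have E_comm: "a ** b = b ** a" if "a \<in> E" "b \<in> E" for a b
    using matrix_commute_span[of b S a] that S(3) by blast
  have HG: "H \<subseteq> G"
    unfolding H_def using U.generate_subgroup_incl[OF _ G] by (auto simp: E_def)
  have HU: "subgroup H ?U"
    unfolding H_def by (rule U.generate_is_subgroup[OF EU])
  have "comm_group (?G\<lparr>carrier := H\<rparr>)"
    using U.comm_group_generate[OF EU] E_comm by (simp add: H_def)
  moreover have "subgroup H ?G" by (rule U.subgroup_incl[OF HU G HG])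
  moreover have "finite (rcosets\<^bsub>?G\<^esub> H)"
    by (rule finite_rcosets_unitary[OF G HU HG, of \<epsilon>])
      (auto simp: \<epsilon>_def H_def E_def intro: generate.incl)
  ultimately show ?thesis unfolding virtually_abelian_def by blast
qed

end
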